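(* Let $n\ge 1$ and let $\mathcal{K}\subseteq\mathcal{S}^n$ be any closed convex cone with $\mathcal{N}^n\subseteq\mathcal{K}\subseteq(\mathcal{SDD}_+^n)^*$. Then the following strict inclusions among faces of $\mathcal{K}$ hold: $$\mathcal{K}[\mathcal{J}_{n,n}]\subsetneq\mathcal{K}[\mathcal{J}_{n-1,n}]\subsetneq\mathcal{K}[\mathcal{J}_{n-1,n-1}]\subsetneq\mathcal{K}[\mathcal{J}_{n-2,n}]\subsetneq\cdots\subsetneq\mathcal{K}[\mathcal{J}_{2,2}]\subsetneq\mathcal{K}[\mathcal{J}_{1,n}]\subsetneq\cdots\subsetneq\mathcal{K}[\mathcal{J}_{1,2}]\subsetneq\mathcal{K}[\mathcal{J}_{1,1}]\subsetneq\mathcal{K}[\mathcal{J}_{0,n}]=\mathcal{K},$$ that is, $\mathcal{K}[\mathcal{J}_{i,j}]\subsetneq\mathcal{K}[\mathcal{J}_{i,j-1}]$ for all $i=1,\dots,n$ and $j=i,\dots,n$, where $\mathcal{J}_{i,i-1}:=\mathcal{J}_{i-1,n}$. In particular, $\ell_{\mathcal{K}}=T_n+1$.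
   Context: $\mathcal{S}^n$ is the space of real $n\times n$ symmetric matrices and $T_n:=\frac{n(n+1)}{2}$. A set $\mathcal{K}\subseteq\mathcal{S}^n$ is a cone if $\alpha A\in\mathcal{K}$ for all $\alpha\ge 0$ and $A\in\mathcal{K}$. The dual of a cone $\mathcal{K}\subseteq\mathcal{S}^n$ is $\mathcal{K}^*:=\{A\in\mathcal{S}^n : \sum_{i,j=1}^n A_{ij}B_{ij}\ge 0\text{ for all }B\in\mathcal{K}\}$. $\mathcal{N}^n$ is the set of matrices in $\mathcal{S}^n$ with only nonnegative elements. $\mathcal{DD}^n:=\{A\in\mathcal{S}^n : A_{ii}\ge\sum_{j\ne i}|A_{ij}|\text{ for all } i=1,\dots,n\}$; $\mathcal{SDD}^n$ is the set of matrices $DAD$ such that $A\in\mathcal{DD}^n$ and $D\in\mathcal{S}^n$ is a diagonal matrix with positive diagonal elements; $\mathcal{SDD}_+^n:=\mathcal{SDD}^n\cap\mathcal{N}^n$. For $i=1,\dots,n$ and $j=i,\dots,n$, let $$\mathcal{J}_{i,j}:=\bigcup_{k=1}^{i-1}\bigcup_{l=k}^{n}\{(k,l)\}\cup\bigcup_{l=i}^{j}\{(i,l)\},$$ and let $\mathcal{J}_{0,n}:=\emptyset$ and $\mathcal{J}_{i,i-1}:=\mathcal{J}_{i-1,n}$ for $i=1,\dots,n$. For a set $\mathcal{J}$ of index pairs, $\mathcal{K}[\mathcal{J}]:=\{A\in\mathcal{K} : A_{ij}=0\text{ for all }(i,j)\in\mathcal{J}\}$. A nonempty convex subcone $\mathcal{F}$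 of a closed convex cone $\mathcal{K}$ is a face of $\mathcal{K}$ if for any $A,B\in\mathcal{K}$, $A+B\in\mathcal{F}$ implies $A,B\in\mathcal{F}$. A chain of faces of $\mathcal{K}$ of length $l$ is a sequence $\mathcal{F}_l\subsetneq\cdots\subsetneq\mathcal{F}_1$ in which every $\mathcal{F}_i$ is a face of $\mathcal{K}$. $\ell_{\mathcal{K}}$ denotes the length of the longest chain of faces of $\mathcal{K}$. *)

theory Defs
  imports "HOL-Analysis.Analysis" "HOL-Library.Extended_Nat"
begin

text \<open>
  Real \<open>n \<times> n\<close> matrices have type \<open>real ^ 'n ^ 'n\<close> with \<open>n = CARD('n)\<close>, so \<open>n \<ge> 1\<close> always.
  The index sets below depend on the order of the indices \<open>1, \<dots>, n\<close>. They are sets of pairs of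
  natural numbers, read as matrix positions through a labelling \<open>e\<close> of the index type, i.e. a
  bijection from \<open>{1..CARD('n)}\<close> onto \<open>UNIV :: 'n set\<close>: the entry \<open>A\<^sub>i\<^sub>j\<close> is \<open>A $ e i $ e j\<close>.
  Notions that do not depend on the order of the indices are stated without \<open>e\<close>.
\<close>

definition sym_mats :: "(real ^ 'n ^ 'n) set" where
  "sym_mats = {A. transpose A = A}"

definition dual_cone :: "(real ^ 'n ^ 'n) set \<Rightarrow> (real ^ 'n ^ 'n) set" where
  "dual_cone K = {A \<in> sym_mats. \<forall>B\<in>K. (\<Sum>i\<in>UNIV. \<Sum>j\<in>UNIV. A $ i $ j * B $ i $ j) \<ge> 0}"

definition nonneg_mats :: "(real ^ 'n ^ 'n) set" where
  "nonneg_mats = {A \<in> sym_mats. \<forall>i j. A $ i $ j \<ge> 0}"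

definition DD :: "(real ^ 'n ^ 'n) set" where
  "DD = {A \<in> sym_mats. \<forall>i. A $ i $ i \<ge> (\<Sum>j\<in>UNIV - {i}. \<bar>A $ i $ j\<bar>)}"

definition pos_diag_mats :: "(real ^ 'n ^ 'n) set" where
  "pos_diag_mats = {D \<in> sym_mats. (\<forall>i j. i \<noteq> j \<longrightarrow> D $ i $ j = 0) \<and> (\<forall>i. D $ i $ i > 0)}"

definition SDD :: "(real ^ 'n ^ 'n) set" where
  "SDD = {D ** A ** D | A D. A \<in> DD \<and> D \<in> pos_diag_mats}"

definition SDD_plus :: "(real ^ 'n ^ 'n) set" where
  "SDD_plus = SDD \<inter> nonneg_mats"

text \<open>
  \<open>index_set n i j\<close> is \<open>\<J>\<^sub>i\<^sub>,\<^sub>j\<close> for matrices of order \<open>n\<close>. The meaningful arguments are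
  \<open>1 \<le> i \<le> j \<le> n\<close> and those covered by the conventions \<open>\<J>\<^sub>0\<^sub>,\<^sub>n = {}\<close> and
  \<open>\<J>\<^sub>i\<^sub>,\<^sub>i\<^sub>-\<^sub>1 = \<J>\<^sub>i\<^sub>-\<^sub>1\<^sub>,\<^sub>n\<close>; the latter is the case \<open>j = i\<close> of the second equation, whose row is \<open>Suc i\<close>.
\<close>

fun index_set :: "nat \<Rightarrow> nat \<Rightarrow> nat \<Rightarrow> (nat \<times> nat) set" where
  "index_set n 0 j = {}"
| "index_set n (Suc i) j =
    (if j = i then index_set n i n
     else (\<Union>k\<in>{1..i}. \<Union>l\<in>{k..n}. {(k, l)}) \<union> (\<Union>l\<in>{Suc i..j}. {(Suc i, l)}))"

definition vanishing_on ::
  "(nat \<Rightarrow> 'n) \<Rightarrow> (real ^ 'n ^ 'n) set \<Rightarrow> (nat \<times> nat) set \<Rightarrow> (real ^ 'n ^ 'n) set" where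
  "vanishing_on e K J = {A \<in> K. \<forall>(i, j)\<in>J. A $ e i $ e j = 0}"

text \<open>
  Unlike the library's \<open>face_of\<close>, which is about convex sets, a face of a cone is here a nonempty
  subcone; \<open>K\<close> is meant to be a closed convex cone.
\<close>

definition cone_face :: "'a::real_vector set \<Rightarrow> 'a set \<Rightarrow> bool" where
  "cone_face F K \<longleftrightarrow> F \<noteq> {} \<and> F \<subseteq> K \<and> convex F \<and> cone F \<and>
     (\<forall>A\<in>K. \<forall>B\<in>K. A + B \<in> F \<longrightarrow> A \<in> F \<and> B \<in> F)"

definition face_chain :: "'a::real_vector set \<Rightarrow> nat \<Rightarrow> (nat \<Rightarrow> 'a set) \<Rightarrow> bool" where
  "face_chain K l F \<longleftrightarrow> (\<forall>i\<in>{1..l}. cone_face (F i) K) \<and> (\<forall>i\<in>{1..<l}. F (Suc i) \<subset> F i)"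

text \<open>
  The supremum is taken in \<^typ>\<open>enat\<close>, so it is infinite if there are arbitrarily long chains, and
  a finite value is attained by some chain.
\<close>

definition longest_face_chain :: "'a::real_vector set \<Rightarrow> enat" where
  "longest_face_chain K = (SUP l\<in>{l. \<exists>F. face_chain K l F}. enat l)"

end

theory Submission imports Defs begin

text \<open>
  Only \<open>2 \<times> 2\<close> principal submatrices matter. For positive \<open>d\<close> and \<open>|S| \<le> 2\<close> the matrix with entries
  \<open>d\<^sub>a d\<^sub>b\<close> on \<open>S \<times> S\<close> and \<open>0\<close> elsewhere lies in \<open>\<S>\<D>\<D>\<^sub>+\<close>. Pairing with it shows that every
  \<open>A \<in> K\<close> has a nonnegative diagonal and, letting \<open>d\<^sub>i \<rightarrow> \<infinity>\<close>, that \<open>A\<^sub>i\<^sub>i = 0\<close> forces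
  \<open>A\<^sub>i\<^sub>j \<ge> 0\<close>. So each entry that is set to zero along the sequence \<open>\<J>\<^sub>i\<^sub>,\<^sub>j\<close> is nonnegative on
  the preceding face, which makes the next set a face; the inclusion is strict because \<open>K\<close> contains
  the nonnegative symmetric matrix supported at that entry. Conversely a face is cut out of \<open>K\<close> by
  its linear span, so dimensions strictly decrease along a chain, and all of them are at most the
  dimension of the space of symmetric matrices.
\<close>

section \<open>Chains of faces and dimension\<close>

lemma cone_face_add:
  assumes "cone_face F K" "x \<in> F" "y \<in> F"
  shows "x + y \<in> F"
proof -
  have "convex F \<and> cone F"
    using assms by (simp add: cone_face_def)
  then show ?thesis
    unfolding convex_cone using assms by blast
qed

lemma cone_face_scaleR:
  assumes "cone_face F K" "x \<in> F" "0 \<le> c"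
  shows "c *\<^sub>R x \<in> F"
  using assms unfolding cone_face_def cone_def by blast

lemma cone_face_zero:
  assumes "cone_face F K"
  shows "0 \<in> F"
  using assms cone_face_scaleR[OF assms, of _ 0] by (auto simp: cone_face_def)

text \<open>If \<open>x\<close> in \<open>K\<close> is a difference \<open>a - b\<close> of members
  of \<open>F\<close>, then \<open>x + b = a\<close> lies in \<open>F\<close>, and the face property
  puts \<open>x\<close> in \<open>F\<close>. Hence a face is determined by its span.\<close>

lemma cone_face_eq_Int_span:
  assumes F: "cone_face F K"
  shows "F = K \<inter> span F"
proof
  show "F \<subseteq> K \<inter> span F"
    using F by (auto simp: cone_face_def span_base)
  \<comment> \<open>A subspace containing \<open>F\<close>, hence containing \<open>span F\<close>;
    a negative scalar swaps the roles of \<open>a\<close> and \<open>b\<close>.\<close>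
  let ?D = "{a - b | a b. a \<in> F \<and> b \<in> F}"
  have "subspace ?D"
  proof (rule subspaceI)
    show "0 \<in> ?D"
      using cone_face_zero[OF F] by force
    show "x + y \<in> ?D" if "x \<in> ?D" "y \<in> ?D" for x y
    proof -
      from that obtain a b a' b' where "x = a - b" "y = a' - b'" "a \<in> F" "b \<in> F" "a' \<in> F" "b' \<in> F"
        by blast
      moreover from this have "x + y = (a + a') - (b + b')"
        by simp
      ultimately show ?thesis
        using cone_face_add[OF F] by blast
    qed
    show "c *\<^sub>R x \<in> ?D" if "x \<in> ?D" for c x
    proof -
      from that obtain a b where x: "x = a - b" "a \<in> F" "b \<in> F"
        by blast
      show ?thesis
      proof (cases "0 \<le> c")
        case True
        have "c *\<^sub>R x = c *\<^sub>R a - c *\<^sub>R b"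
          using x by (simp add: scaleR_diff_right)
        then show ?thesis
          using x True cone_face_scaleR[OF F] by blast
      next
        case False
        have "c *\<^sub>R x = (- c) *\<^sub>R b - (- c) *\<^sub>R a"
          using x by (simp add: scaleR_diff_right)
        moreover have "0 \<le> - c"
          using False by simp
        ultimately show ?thesis
          using x cone_face_scaleR[OF F] by blast
      qed
    qed
  qed
  moreover have "F \<subseteq> ?D"
    using cone_face_zero[OF F] by force
  ultimately have span: "span F \<subseteq> ?D"
    by (rule span_minimal[rotated])
  show "K \<inter> span F \<subseteq> F"
  proof
    fix x assume x: "x \<in> K \<inter> span F"
    with span obtain a b where ab: "x = a - b" "a \<in> F" "b \<in> F"
      by blast
    then have "x + b \<in> F" "b \<in> K"
      using F by (auto simp: cone_face_def)
    with x F show "x \<in> F"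
      unfolding cone_face_def by blast
  qed
qed

text \<open>Nested spans of equal dimension coincide, and faces with equal spans are equal.\<close>

lemma cone_face_dim_less:
  fixes F G K :: "'a::euclidean_space set"
  assumes "cone_face F K" "cone_face G K" "F \<subset> G"
  shows "dim F < dim G"
proof (rule ccontr)
  assume "\<not> dim F < dim G"
  then have "span F = span G"
    using assms(3) by (intro dim_eq_span) auto
  with assms show False
    using cone_face_eq_Int_span[of F K] cone_face_eq_Int_span[of G K] by auto
qed

lemma face_chain_length_le_dim:
  fixes K :: "'a::euclidean_space set"
  assumes "face_chain K l F"
  shows "l \<le> dim K + 1"
proof -
  \<comment> \<open>The dimension starts at most at \<open>dim K\<close> and drops by at least 1 per
    link; the summand 1 leaves room for a last face of dimension 0.\<close>
  have "i \<le> l \<Longrightarrow> dim (F i) + i \<le> dim K + 1" if "1 \<le> i" for i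
    using that
  proof (induction i rule: dec_induct)
    case base
    then have "F 1 \<subseteq> K"
      using assms by (auto simp: face_chain_def cone_face_def)
    then show ?case
      by (simp add: dim_subset)
  next
    case (step i)
    have "dim (F (Suc i)) < dim (F i)"
      using assms step by (intro cone_face_dim_less[of _ K]) (auto simp: face_chain_def)
    with step show ?case
      by simp
  qed
  then show ?thesis
    by (cases "l = 0") (auto dest: meta_spec[of _ l])
qed

lemma face_chain_extend:
  assumes "face_chain K l F" "cone_face G K" "G \<subset> F l"
  shows "face_chain K (Suc l) (F(Suc l := G))"
  unfolding face_chain_def
proof (intro conjI ballI)
  show "cone_face ((F(Suc l := G)) i) K" if "i \<in> {1..Suc l}" for i
    using that assms by (cases "i = Suc l") (auto simp: face_chain_def)
  show "(F(Suc l := G)) (Suc i) \<subset> (F(Suc l := G)) i" if "i \<in> {1..<Suc l}" for i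
    using that assms by (cases "i = l") (auto simp: face_chain_def)
qed

section \<open>Symmetric matrices\<close>

text \<open>Comparing unordered pairs makes the matrix symmetric by construction and also covers
  \<open>i = j\<close>.\<close>

definition sym_unit :: "'n \<Rightarrow> 'n \<Rightarrow> real ^ 'n ^ 'n" where
  "sym_unit i j = (\<chi> a b. if {a, b} = {i, j} then 1 else 0)"

lemma sym_unit_in_nonneg_mats: "sym_unit i j \<in> nonneg_mats"
  by (simp add: sym_unit_def nonneg_mats_def sym_mats_def transpose_def vec_eq_iff doubleton_eq_iff)

lemma sym_mats_nth: "A \<in> sym_mats \<Longrightarrow> A $ a $ b = A $ b $ a"
  by (simp add: sym_mats_def transpose_def vec_eq_iff)

text \<open>These positions serve as coordinates of a symmetric matrix; they also form the last
  index set of the chain.\<close>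

definition upper_pairs :: "nat \<Rightarrow> (nat \<times> nat) set" where
  "upper_pairs n = (SIGMA k:{1..n}. {k..n})"

lemma finite_upper_pairs [simp]: "finite (upper_pairs n)"
  by (simp add: upper_pairs_def)

lemma card_upper_pairs: "card (upper_pairs n) = n * (n + 1) div 2"
proof -
  have "card (upper_pairs n) = (\<Sum>k=1..n. Suc n - k)"
    by (simp add: upper_pairs_def)
  also have "\<dots> = (\<Sum>k=1..n. k)"
    by (rule sum.reindex_bij_witness[of _ "\<lambda>k. Suc n - k" "\<lambda>k. Suc n - k"]) auto
  also have "\<dots> = n * (n + 1) div 2"
    using gauss_sum_from_Suc_0[of n, where ?'a = nat] by simp
  finally show ?thesis .
qed

lemma sym_mats_expansion:
  fixes A :: "real ^ 'n ^ 'n"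
  assumes e: "bij_betw e {1..n} (UNIV :: 'n set)" and A: "A \<in> sym_mats"
  shows "A = (\<Sum>(k, l)\<in>upper_pairs n. A $ e k $ e l *\<^sub>R sym_unit (e k) (e l))"
proof -
  let ?S = "\<Sum>(k, l)\<in>upper_pairs n. A $ e k $ e l *\<^sub>R sym_unit (e k) (e l)"
  \<comment> \<open>Exactly one summand survives at each matrix position: \<open>e\<close> is
    injective on the labels, and \<open>k \<le> l\<close> fixes the order of the pair.\<close>
  have eq_iff: "{e p, e q} = {e k, e l} \<longleftrightarrow> (k, l) = (min p q, max p q)"
    if "p \<in> {1..n}" "q \<in> {1..n}" "(k, l) \<in> upper_pairs n" for p q k l
  proof -
    have inj: "e x = e y \<longleftrightarrow> x = y" if "x \<in> {1..n}" "y \<in> {1..n}" for x y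
      using e that by (metis bij_betw_def inj_on_eq_iff)
    from that have "k \<in> {1..n}" "l \<in> {1..n}" "k \<le> l"
      by (auto simp: upper_pairs_def)
    with that show ?thesis
      by (auto simp: doubleton_eq_iff inj min_def max_def)
  qed
  have "A $ a $ b = ?S $ a $ b" for a b
  proof -
    have "a \<in> e ` {1..n}" "b \<in> e ` {1..n}"
      using e by (simp_all add: bij_betw_def)
    then obtain p q where pq: "p \<in> {1..n}" "q \<in> {1..n}" "a = e p" "b = e q"
      by blast
    have "?S $ a $ b = (\<Sum>z\<in>upper_pairs n. if z = (min p q, max p q) then A $ e (fst z) $ e (snd z) else 0)"
      unfolding sum_component
    proof (rule sum.cong)
      fix z assume "z \<in> upper_pairs n"
      then show "(case z of (k, l) \<Rightarrow> A $ e k $ e l *\<^sub>R sym_unit (e k) (e l)) $ a $ b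
          = (if z = (min p q, max p q) then A $ e (fst z) $ e (snd z) else 0)"
        using eq_iff[OF pq(1,2), of "fst z" "snd z"]
        by (simp add: sym_unit_def pq(3,4) case_prod_unfold)
    qed simp
    also have "\<dots> = A $ e (min p q) $ e (max p q)"
      using pq by (auto simp: upper_pairs_def)
    also have "\<dots> = A $ a $ b"
      using sym_mats_nth[OF A] pq by (simp add: min_def max_def)
    finally show ?thesis
      by simp
  qed
  then show ?thesis
    unfolding vec_eq_iff by blast
qed

lemma dim_sym_mats_le: "dim (sym_mats :: (real ^ 'n ^ 'n) set) \<le> CARD('n) * (CARD('n) + 1) div 2"
proof -
  obtain e where e: "bij_betw e {1..CARD('n)} (UNIV :: 'n set)"
    using ex_bij_betw_nat_finite_1[OF finite] by blast
  let ?B = "(\<lambda>(k, l). sym_unit (e k) (e l)) ` upper_pairs CARD('n)"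
  have "A \<in> span ?B" if "A \<in> sym_mats" for A
    by (subst sym_mats_expansion[OF e that], rule span_sum) (force intro: span_scale[OF span_base])
  then have "dim (sym_mats :: (real ^ 'n ^ 'n) set) \<le> card ?B"
    by (intro dim_le_card) auto
  also have "\<dots> \<le> card (upper_pairs CARD('n))"
    by (rule card_image_le) simp
  finally show ?thesis
    by (simp only: card_upper_pairs)
qed

section \<open>Entries of matrices in the dual cone\<close>

lemma diag_sandwich_nth:
  fixes A :: "real ^ 'n ^ 'n"
  shows "((\<chi> a b. if a = b then d a else 0) ** A ** (\<chi> a b. if a = b then d a else 0)) $ a $ b
    = d a * A $ a $ b * d b"
  by (simp add: matrix_matrix_mult_def if_distrib[of "\<lambda>x. x * _"] if_distrib[of "\<lambda>x. _ * x"]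
      cong: if_cong)

text \<open>The matrix is the 0/1 indicator of \<open>S \<times> S\<close> scaled on both sides by
  the diagonal matrix of \<open>d\<close>. The indicator is diagonally dominant because a row in
  \<open>S\<close> has at most one off-diagonal 1, which is where \<open>card S \<le> 2\<close>
  enters.\<close>

lemma scaled_block_in_SDD_plus:
  fixes d :: "'n::finite \<Rightarrow> real" and S :: "'n set"
  assumes d: "\<And>a. 0 < d a" and S: "card S \<le> 2"
  shows "(\<chi> a b. if a \<in> S \<and> b \<in> S then d a * d b else 0) \<in> SDD_plus"
proof -
  let ?M = "(\<chi> a b. if a \<in> S \<and> b \<in> S then 1 else 0) :: real ^ 'n ^ 'n"
  let ?D = "(\<chi> a b. if a = b then d a else 0) :: real ^ 'n ^ 'n"
  let ?B = "(\<chi> a b. if a \<in> S \<and> b \<in> S then d a * d b else 0) :: real ^ 'n ^ 'n"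
  have "(\<Sum>b\<in>UNIV - {a}. \<bar>?M $ a $ b\<bar>) \<le> ?M $ a $ a" for a
  proof (cases "a \<in> S")
    case True
    have "(\<Sum>b\<in>UNIV - {a}. \<bar>?M $ a $ b\<bar>) = (\<Sum>b\<in>S - {a}. 1)"
      using True by (intro sum.mono_neutral_cong_right) auto
    also have "\<dots> \<le> 1"
      using True S by (simp add: card_Diff_singleton)
    finally show ?thesis
      using True by simp
  qed simp
  then have "?M \<in> DD"
    by (auto simp: DD_def sym_mats_def transpose_def vec_eq_iff)
  moreover have "?D \<in> pos_diag_mats"
    using d by (auto simp: pos_diag_mats_def sym_mats_def transpose_def vec_eq_iff)
  moreover have "?B = ?D ** ?M ** ?D"
    by (simp add: vec_eq_iff diag_sandwich_nth)
  ultimately have "?B \<in> SDD"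
    unfolding SDD_def by blast
  moreover have "?B \<in> nonneg_mats"
    using d by (auto simp: nonneg_mats_def sym_mats_def transpose_def vec_eq_iff less_imp_le)
  ultimately show ?thesis
    by (simp add: SDD_plus_def)
qed

lemma dual_SDD_plus_block_nonneg:
  fixes A :: "real ^ 'n ^ 'n"
  assumes A: "A \<in> dual_cone SDD_plus" and d: "\<And>a. 0 < d a" and S: "card S \<le> 2"
  shows "0 \<le> (\<Sum>a\<in>S. \<Sum>b\<in>S. A $ a $ b * (d a * d b))"
proof -
  let ?B = "(\<chi> a b. if a \<in> S \<and> b \<in> S then d a * d b else 0) :: real ^ 'n ^ 'n"
  have "0 \<le> (\<Sum>a\<in>UNIV. \<Sum>b\<in>UNIV. A $ a $ b * ?B $ a $ b)"
    using A scaled_block_in_SDD_plus[of d S, OF d S] unfolding dual_cone_def by blast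
  also have "\<dots> = (\<Sum>a\<in>S. \<Sum>b\<in>UNIV. A $ a $ b * ?B $ a $ b)"
    by (rule sum.mono_neutral_right) auto
  also have "\<dots> = (\<Sum>a\<in>S. \<Sum>b\<in>S. A $ a $ b * (d a * d b))"
    by (intro sum.cong refl sum.mono_neutral_cong_right) auto
  finally show ?thesis .
qed

lemma dual_SDD_plus_diag_nonneg:
  assumes "A \<in> dual_cone SDD_plus"
  shows "0 \<le> A $ a $ a"
  using dual_SDD_plus_block_nonneg[OF assms, of "\<lambda>_. 1" "{a}"] by simp

lemma dual_SDD_plus_offdiag_nonneg:
  assumes A: "A \<in> dual_cone SDD_plus" and zero: "A $ a $ a = 0" and "a \<noteq> b"
  shows "0 \<le> A $ a $ b"
proof (rule ccontr)
  assume neg: "\<not> 0 \<le> A $ a $ b"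
  have bb: "0 \<le> A $ b $ b"
    by (rule dual_SDD_plus_diag_nonneg[OF A])
  have sym: "A $ b $ a = A $ a $ b"
    using A by (intro sym_mats_nth) (simp add: dual_cone_def)
  \<comment> \<open>Since \<open>A $ a $ a = 0\<close>, the pairing has no quadratic term in
    \<open>t\<close>; this choice makes it \<open>- A $ b $ b - 2\<close>, which is negative. The
    added 1 keeps \<open>t\<close> positive when \<open>A $ b $ b = 0\<close>.\<close>
  define t where "t = (A $ b $ b + 1) / (- A $ a $ b)"
  have t: "0 < t"
    unfolding t_def using neg bb by (intro divide_pos_pos) auto
  have "0 \<le> (\<Sum>x\<in>{a, b}. \<Sum>y\<in>{a, b}. A $ x $ y * ((if x = a then t else 1) * (if y = a then t else 1)))"
    using t assms(3) by (intro dual_SDD_plus_block_nonneg[OF A]) auto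
  also have "\<dots> = 2 * (t * A $ a $ b) + A $ b $ b"
    using assms(3) zero sym by simp
  also have "t * A $ a $ b = - (A $ b $ b + 1)"
    using neg by (simp add: t_def field_simps)
  finally show False
    using bb by simp
qed

section \<open>The faces cut out by the index sets\<close>

text \<open>The recursion lists the upper triangle row by row up to the position
  \<open>(i, j)\<close>. The bound \<open>i \<le> Suc j\<close> admits the convention
  \<open>j = i - 1\<close>, where the second disjunct is empty.\<close>

lemma index_set_eq:
  assumes "i \<le> Suc j" "j \<le> n" "i \<le> n"
  shows "index_set n i j = {(k, l) \<in> upper_pairs n. k < i \<or> k = i \<and> l \<le> j}"
  using assms
proof (induction i arbitrary: j)
  case 0
  then show ?case
    by (auto simp: upper_pairs_def)
next
  case (Suc i)
  show ?case
  proof (cases "j = i")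
    case True
    then show ?thesis
      using Suc.IH[of n] Suc.prems by (auto simp: upper_pairs_def)
  next
    case False
    then show ?thesis
      using Suc.prems by (auto simp: upper_pairs_def)
  qed
qed

lemma index_set_first: "index_set n i (i - 1) = index_set n (i - 1) n"
  by (cases i) simp_all

lemma index_set_step:
  assumes "i \<in> {1..n}" "j \<in> {i..n}"
  shows "index_set n i j = insert (i, j) (index_set n i (j - 1))"
    and "(i, j) \<notin> index_set n i (j - 1)"
proof -
  have "index_set n i (j - 1) = {(k, l) \<in> upper_pairs n. k < i \<or> k = i \<and> l \<le> j - 1}"
    using assms by (intro index_set_eq) auto
  moreover have "index_set n i j = {(k, l) \<in> upper_pairs n. k < i \<or> k = i \<and> l \<le> j}"
    using assms by (intro index_set_eq) auto
  ultimately show "index_set n i j = insert (i, j) (index_set n i (j - 1))"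
    "(i, j) \<notin> index_set n i (j - 1)"
    using assms by (auto simp: upper_pairs_def)
qed

text \<open>Induction along the row-by-row order; the change of row is hidden in the convention for
  \<open>index_set n i (i - 1)\<close>.\<close>

lemma index_set_induct [consumes 2, case_names empty step]:
  assumes "i \<in> {1..n}" "j \<in> {i..n}"
    and empty: "P {}"
    and step: "\<And>i j. i \<in> {1..n} \<Longrightarrow> j \<in> {i..n} \<Longrightarrow> P (index_set n i (j - 1)) \<Longrightarrow> P (index_set n i j)"
  shows "P (index_set n i j)"
proof -
  \<comment> \<open>Progress within one row from the completed previous row; an induction over
    completed rows follows.\<close>
  have row: "P (index_set n i j)" if "i \<in> {1..n}" "j \<le> n" "P (index_set n (i - 1) n)" "i \<le> j" for i j
    using that(4,1-3)
  proof (induction j rule: dec_induct)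
    case base
    then have "P (index_set n i (i - 1))"
      by (simp only: index_set_first)
    with base show ?case
      by (auto intro: step[of i i])
  next
    case (step j)
    then show ?case
      by (auto intro: assms(4)[of i "Suc j"])
  qed
  have "P (index_set n i n)" if "i \<le> n" for i
    using that
  proof (induction i)
    case (Suc i)
    then show ?case
      using row[of "Suc i" n] by (simp del: index_set.simps)
  qed (simp add: empty)
  with assms(1,2) show ?thesis
    by (auto intro: row[of i j])
qed

section \<open>Faces given by vanishing entries, and the chain they form\<close>

lemma cone_face_refl:
  assumes "convex K" "cone K" "K \<noteq> {}"
  shows "cone_face K K"
  using assms by (simp add: cone_face_def)

text \<open>Summands in \<open>K\<close> first fall into the given face; there their entries at
  \<open>(i, j)\<close> are nonnegative with sum 0, so both vanish.\<close>

lemma cone_face_vanishing_insert: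
  assumes F: "cone_face (vanishing_on e K J) K"
    and nonneg: "\<And>A. A \<in> vanishing_on e K J \<Longrightarrow> 0 \<le> A $ e i $ e j"
  shows "cone_face (vanishing_on e K (insert (i, j) J)) K"
proof -
  let ?F = "vanishing_on e K J" and ?G = "vanishing_on e K (insert (i, j) J)"
  have G: "A \<in> ?G \<longleftrightarrow> A \<in> ?F \<and> A $ e i $ e j = 0" for A
    by (auto simp: vanishing_on_def)
  have "0 \<in> ?G"
    using cone_face_zero[OF F] by (simp add: G)
  moreover have "convex ?G \<and> cone ?G"
    unfolding convex_cone by (auto simp: G cone_face_add[OF F] cone_face_scaleR[OF F])
  moreover have "A \<in> ?G \<and> B \<in> ?G" if "A \<in> K" "B \<in> K" "A + B \<in> ?G" for A B
  proof -
    have AB: "A \<in> ?F" "B \<in> ?F"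
      using F that unfolding cone_face_def G by blast+
    moreover have "A $ e i $ e j + B $ e i $ e j = 0"
      using that by (simp add: G)
    ultimately show ?thesis
      using nonneg[OF AB(1)] nonneg[OF AB(2)] by (simp add: G)
  qed
  moreover have "?G \<subseteq> K"
    by (auto simp: vanishing_on_def)
  ultimately show ?thesis
    unfolding cone_face_def by blast
qed

text \<open>Each row starts at its diagonal position, so \<open>A $ e i $ e i\<close> is already 0
  when an off-diagonal entry of row \<open>i\<close> is reached.\<close>

lemma vanishing_on_index_set_nonneg:
  assumes K: "K \<subseteq> dual_cone SDD_plus" and e: "inj_on e {1..n}"
    and ij: "i \<in> {1..n}" "j \<in> {i..n}"
    and A: "A \<in> vanishing_on e K (index_set n i (j - 1))"
  shows "0 \<le> A $ e i $ e j"
proof -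
  have dual: "A \<in> dual_cone SDD_plus"
    using A K by (auto simp: vanishing_on_def)
  show ?thesis
  proof (cases "i = j")
    case True
    then show ?thesis
      using dual_SDD_plus_diag_nonneg[OF dual] by simp
  next
    case False
    then have "(i, i) \<in> index_set n i (j - 1)"
      using ij by (auto simp: index_set_eq upper_pairs_def)
    then have "A $ e i $ e i = 0"
      using A by (auto simp: vanishing_on_def)
    moreover have "e i \<noteq> e j"
      using False ij inj_on_eq_iff[OF e, of i j] by simp
    ultimately show ?thesis
      by (rule dual_SDD_plus_offdiag_nonneg[OF dual])
  qed
qed

lemma cone_face_index_set:
  assumes K: "cone_face K K" "K \<subseteq> dual_cone SDD_plus" and e: "inj_on e {1..n}"
    and ij: "i \<in> {1..n}" "j \<in> {i..n}"
  shows "cone_face (vanishing_on e K (index_set n i j)) K"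
  using ij
proof (induction rule: index_set_induct)
  case empty
  then show ?case
    using K by (simp add: vanishing_on_def)
next
  case (step i j)
  show ?case
    unfolding index_set_step(1)[OF step.hyps]
    using step.IH vanishing_on_index_set_nonneg[OF K(2) e step.hyps]
    by (rule cone_face_vanishing_insert)
qed

lemma vanishing_on_index_set_strict:
  assumes K: "nonneg_mats \<subseteq> K" and e: "inj_on e {1..n}"
    and ij: "i \<in> {1..n}" "j \<in> {i..n}"
  shows "vanishing_on e K (index_set n i j) \<subset> vanishing_on e K (index_set n i (j - 1))"
proof -
  let ?E = "sym_unit (e i) (e j)"
  have "?E $ e k $ e l = 0" if "(k, l) \<in> index_set n i (j - 1)" for k l
  proof -
    have kl: "k \<in> {1..n}" "l \<in> {1..n}" "k \<le> l"
      using that ij by (auto simp: index_set_eq upper_pairs_def)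
    have "(k, l) \<noteq> (i, j)"
      using that index_set_step(2)[OF ij] by metis
    moreover have inj: "e x = e y \<longleftrightarrow> x = y" if "x \<in> {1..n}" "y \<in> {1..n}" for x y
      using e that by (simp add: inj_on_eq_iff)
    \<comment> \<open>Both pairs are ordered, so equal doubletons would force
      \<open>(k, l) = (i, j)\<close>.\<close>
    ultimately have "{e k, e l} \<noteq> {e i, e j}"
      using kl ij by (auto simp: doubleton_eq_iff inj)
    then show ?thesis
      by (simp add: sym_unit_def)
  qed
  then have "?E \<in> vanishing_on e K (index_set n i (j - 1))"
    using K sym_unit_in_nonneg_mats[of "e i" "e j"] by (auto simp: vanishing_on_def)
  moreover have "?E \<notin> vanishing_on e K (index_set n i j)"
    by (auto simp: index_set_step(1)[OF ij] vanishing_on_def sym_unit_def)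
  moreover have "vanishing_on e K (index_set n i j) \<subseteq> vanishing_on e K (index_set n i (j - 1))"
    by (auto simp: index_set_step(1)[OF ij] vanishing_on_def)
  ultimately show ?thesis
    by blast
qed

text \<open>Each position adds one link to the chain consisting of \<open>K\<close> alone, which has
  length 1; recording the last face lets the induction append the next one.\<close>

lemma face_chain_index_set:
  assumes K: "cone_face K K" "K \<subseteq> dual_cone SDD_plus" "nonneg_mats \<subseteq> K"
    and e: "inj_on e {1..n}"
    and ij: "i \<in> {1..n}" "j \<in> {i..n}"
  shows "\<exists>F. face_chain K (Suc (card (index_set n i j))) F
    \<and> F (Suc (card (index_set n i j))) = vanishing_on e K (index_set n i j)"
  using ij
proof (induction rule: index_set_induct)
  case empty
  show ?case
    using K(1) by (intro exI[of _ "\<lambda>_. K"]) (auto simp: face_chain_def vanishing_on_def)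
next
  case (step i j)
  let ?J = "index_set n i (j - 1)"
  have "index_set n i (j - 1) \<subseteq> upper_pairs n"
    using step.hyps by (auto simp: index_set_eq)
  then have "finite ?J"
    by (rule finite_subset) simp
  then have card: "card (index_set n i j) = Suc (card ?J)"
    using index_set_step[OF step.hyps] by simp
  from step.IH obtain F where F: "face_chain K (Suc (card ?J)) F"
    "F (Suc (card ?J)) = vanishing_on e K ?J"
    by blast
  have "face_chain K (Suc (Suc (card ?J)))
      (F(Suc (Suc (card ?J)) := vanishing_on e K (index_set n i j)))"
    using F(1) cone_face_index_set[OF K(1,2) e step.hyps]
  proof (rule face_chain_extend)
    show "vanishing_on e K (index_set n i j) \<subset> F (Suc (card ?J))"
      unfolding F(2) using K(3) e step.hyps by (rule vanishing_on_index_set_strict)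
  qed
  then show ?case
    unfolding card by (metis fun_upd_same)
qed

theorem proposition4p3:
  fixes K :: "(real ^ 'n ^ 'n) set" and e :: "nat \<Rightarrow> 'n" and n :: nat
  assumes "n = CARD('n)"
    and "bij_betw e {1..n} UNIV"
    and "closed K" and "convex K" and "cone K"
    and "nonneg_mats \<subseteq> K" and "K \<subseteq> dual_cone SDD_plus"
  shows "vanishing_on e K (index_set n 0 n) = K
    \<and> cone_face K K
    \<and> (\<forall>i\<in>{1..n}. \<forall>j\<in>{i..n}.
         cone_face (vanishing_on e K (index_set n i j)) K
         \<and> vanishing_on e K (index_set n i j) \<subset> vanishing_on e K (index_set n i (j - 1)))
    \<and> longest_face_chain K = enat (n * (n + 1) div 2 + 1)"
proof -
  have e: "inj_on e {1..n}"
    using assms(2) by (rule bij_betw_imp_inj_on)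
  have K: "cone_face K K"
  proof (rule cone_face_refl[OF assms(4,5)])
    show "K \<noteq> {}"
      using assms(6) sym_unit_in_nonneg_mats[of "e 1" "e 1"] by auto
  qed
  have n: "n \<in> {1..n}"
    using assms(1) by (simp add: Suc_le_eq)
  \<comment> \<open>The last index set exhausts the upper triangle, so the constructed chain has
    length T_n + 1.\<close>
  have "index_set n n n = upper_pairs n"
    using n by (auto simp: index_set_eq upper_pairs_def)
  then have card: "Suc (card (index_set n n n)) = n * (n + 1) div 2 + 1"
    by (simp only: card_upper_pairs Suc_eq_plus1)
  have "n \<in> {n..n}"
    by simp
  from face_chain_index_set[OF K assms(7,6) e n this]
  obtain F where chain: "face_chain K (n * (n + 1) div 2 + 1) F"
    unfolding card by blast
  \<comment> \<open>The dimension bound for chains matches this length, as \<open>K\<close> consists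
    of symmetric matrices.\<close>
  have bound: "l \<le> n * (n + 1) div 2 + 1" if "face_chain K l F" for l F
  proof -
    have "K \<subseteq> sym_mats"
      using assms(7) by (auto simp: dual_cone_def)
    then have "dim K \<le> dim (sym_mats :: (real ^ 'n ^ 'n) set)"
      by (rule dim_subset)
    also have "\<dots> \<le> n * (n + 1) div 2"
      unfolding assms(1) by (rule dim_sym_mats_le)
    finally show ?thesis
      using face_chain_length_le_dim[OF that] by simp
  qed
  have "longest_face_chain K = enat (n * (n + 1) div 2 + 1)"
    unfolding longest_face_chain_def
  proof (rule antisym)
    show "(SUP l\<in>{l. \<exists>F. face_chain K l F}. enat l) \<le> enat (n * (n + 1) div 2 + 1)"
    proof (rule SUP_least)
      fix l assume "l \<in> {l. \<exists>F. face_chain K l F}"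
      then obtain F where "face_chain K l F"
        by blast
      from bound[OF this] show "enat l \<le> enat (n * (n + 1) div 2 + 1)"
        by (simp only: enat_ord_simps)
    qed
    have "n * (n + 1) div 2 + 1 \<in> {l. \<exists>F. face_chain K l F}"
      using chain by blast
    then show "enat (n * (n + 1) div 2 + 1) \<le> (SUP l\<in>{l. \<exists>F. face_chain K l F}. enat l)"
      by (rule SUP_upper)
  qed
  moreover have "vanishing_on e K (index_set n 0 n) = K"
    by (simp add: vanishing_on_def)
  ultimately show ?thesis
    using K cone_face_index_set[OF K assms(7) e] vanishing_on_index_set_strict[OF assms(6) e]
    by blast
qed

end
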